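(* For any estimator $\widehat A\in\mathbb R^{p\times K}$ of $A$ with columns in $\Delta_p$ and the plug-in estimators $\widehat T^{(i)},\widehat T^{(j)}\in\Delta_K$ based on this $\widehat A$, put $\widetilde\Pi^{(\ell)}=\widehat A\widehat T^{(\ell)}$ for $\ell\in\{i,j\}$ and $$R(\widehat A,\widehat T^{(i)},\widehat T^{(j)})=\min_{P\in\mathcal H_K}\left\{\|\widehat A-AP\|_{1,\infty}+\frac12\sum_{\ell\in\{i,j\}}\|\widehat T^{(\ell)}-P^\top T_*^{(\ell)}\|_1\right\}.$$ Then $$\left|W_1(\widetilde\Pi^{(i)},\widetilde\Pi^{(j)};D^{\rm word})-W_1(\Pi_*^{(i)},\Pi_*^{(j)};D^{\rm word})\right|\le\|\boldsymbol D^{\rm word}\|_\infty\,R(\widehat A,\widehat T^{(i)},\widehat T^{(j)}),$$ $$\left|W_1(\widehat T^{(i)},\widehat T^{(j)};\widehat D^{\rm topic}_W)-W_1(T_*^{(i)},T_*^{(j)};D^{\rm topic}_W)\right|\le\|\boldsymbol D^{\rm word}\|_\infty\,R(\widehat A,\widehat T^{(i)},\widehat T^{(j)}),$$ $$\left|W_1(\widehat T^{(i)},\widehat T^{(j)};\widehat D^{\rm topic}_{TV})-W_1(T_*^{(i)},T_*^{(j)};D^{\rm topic}_{TV})\right|\le R(\widehat A,\widehat T^{(i)},\widehat T^{(j)}).$$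
   Context: Setting. $\Delta_d$ is the probability simplex in $\mathbb R^d$; $A\in\mathbb R^{p\times K}$ has columns $A_{\cdot k}\in\Delta_p$; $T_*^{(i)},T_*^{(j)}\in\Delta_K$, $\Pi_*^{(\ell)}=AT_*^{(\ell)}\in\Delta_p$, and the word frequency vector of document $\ell$ satisfies $N_\ell X^{(\ell)}\sim\mathrm{Multinomial}_p(N_\ell;\Pi_*^{(\ell)})$. $\mathcal H_K$ is the set of $K\times K$ permutation matrices. $\|B\|_{1,\infty}=\max_k\|B_{\cdot k}\|_1$ is the maximal column $\ell_1$-norm and $\|B\|_\infty$ the maximal absolute entry of a matrix $B$. Estimators. Given $\widehat A$, $\widehat T^{(\ell)}\in\arg\max_{T\in\Delta_K}\sum_{j:X^{(\ell)}_j>0}X^{(\ell)}_j\log(\widehat A_{j\cdot}^\top T)$. Wasserstein distance. For a metric $D$ on a set with $L$ elements, with matrix $\boldsymbol D=(D(a,b))_{a,b\in[L]}$, and $\gamma,\eta\in\Delta_L$, $W_1(\gamma,\eta;D)=\inf_{w\in\Gamma(\gamma,\eta)}\mathrm{tr}(w\boldsymbol D)$, where $\Gamma(\gamma,\eta)$ is the set of nonnegative $L\times L$ matrices with row sums $\gamma$ and column sums $\eta$ (couplings). Ground distances. Each word $a\in[p]$ is represented by a vector $x_a\in\mathbb R^d$ and $D^{\rm word}(a,b)=\|x_a-x_b\|_2$. For $k,\ell\in[K]$: $D^{\rm topic}_W(k,\ell)=W_1(A_{\cdot k},A_{\cdot\ell};D^{\rm word})$, $\widehat D^{\rm topic}_W(k,\ell)=W_1(\widehat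 A_{\cdot k},\widehat A_{\cdot\ell};D^{\rm word})$, $D^{\rm topic}_{TV}(k,\ell)=\frac12\|A_{\cdot k}-A_{\cdot\ell}\|_1$, $\widehat D^{\rm topic}_{TV}(k,\ell)=\frac12\|\widehat A_{\cdot k}-\widehat A_{\cdot\ell}\|_1$. *)

theory Defs
  imports "HOL-Probability.Probability"
begin

definition prob_simplex :: "(real ^ 'n::finite) set" where
  "prob_simplex = {v. (\<forall>a. 0 \<le> v $ a) \<and> (\<Sum>a\<in>UNIV. v $ a) = 1}"

definition l1_norm :: "real ^ 'n::finite \<Rightarrow> real" where
  "l1_norm v = (\<Sum>a\<in>UNIV. \<bar>v $ a\<bar>)"

definition max_col_norm :: "real ^ 'k::finite ^ 'p::finite \<Rightarrow> real" where
  "max_col_norm B = (MAX k. l1_norm (column k B))"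

definition max_entry_norm :: "real ^ 'k::finite ^ 'p::finite \<Rightarrow> real" where
  "max_entry_norm B = (MAX (a, b). \<bar>B $ a $ b\<bar>)"

definition perm_matrices :: "(real ^ 'k::finite ^ 'k) set" where
  "perm_matrices =
     {P. \<exists>s. s permutes UNIV \<and> P = (\<chi> a b. if a = s b then 1 else 0)}"

definition couplings :: "real ^ 'l::finite \<Rightarrow> real ^ 'l \<Rightarrow> (real ^ 'l ^ 'l) set" where
  "couplings \<gamma> \<eta> =
     {w. (\<forall>a b. 0 \<le> w $ a $ b) \<and>
         (\<forall>a. (\<Sum>b\<in>UNIV. w $ a $ b) = \<gamma> $ a) \<and>
         (\<forall>b. (\<Sum>a\<in>UNIV. w $ a $ b) = \<eta> $ b)}"

definition dist_matrix :: "('l::finite \<Rightarrow> 'l \<Rightarrow> real) \<Rightarrow> real ^ 'l ^ 'l" where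
  "dist_matrix D = (\<chi> a b. D a b)"

definition wasserstein1 ::
  "real ^ 'l::finite \<Rightarrow> real ^ 'l \<Rightarrow> ('l \<Rightarrow> 'l \<Rightarrow> real) \<Rightarrow> real" where
  "wasserstein1 \<gamma> \<eta> D = (INF w\<in>couplings \<gamma> \<eta>. trace (w ** dist_matrix D))"

definition D_word :: "('p::finite \<Rightarrow> real ^ 'd::finite) \<Rightarrow> 'p \<Rightarrow> 'p \<Rightarrow> real" where
  "D_word x a b = norm (x a - x b)"

definition D_topic_W ::
  "('p::finite \<Rightarrow> real ^ 'd::finite) \<Rightarrow> real ^ 'k::finite ^ 'p \<Rightarrow> 'k \<Rightarrow> 'k \<Rightarrow> real" where
  "D_topic_W x A k l = wasserstein1 (column k A) (column l A) (D_word x)"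

definition D_topic_TV :: "real ^ 'k::finite ^ 'p::finite \<Rightarrow> 'k \<Rightarrow> 'k \<Rightarrow> real" where
  "D_topic_TV A k l = 1 / 2 * l1_norm (column k A - column l A)"

text \<open>The law of a vector of multinomial counts, as a measure on real vectors.\<close>

definition multinomial :: "nat \<Rightarrow> real ^ 'p::finite \<Rightarrow> (real ^ 'p) measure" where
  "multinomial N q =
     distr
       (density (count_space (UNIV :: (nat ^ 'p) set))
         (\<lambda>c. if (\<Sum>a\<in>UNIV. c $ a) = N
              then ennreal (fact N / (\<Prod>a\<in>UNIV. fact (c $ a)) * (\<Prod>a\<in>UNIV. (q $ a) ^ (c $ a)))
              else 0))
       borel (\<lambda>c. \<chi> a. real (c $ a))"

text \<open>
  The likelihood of a mixture may vanish at an observed word. Since \<open>ln 0 = 0\<close> for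
  real numbers, the logarithm is taken with values in the extended reals, where it is
  \<open>-\<infinity>\<close> at zero.
\<close>

definition ext_log :: "real \<Rightarrow> ereal" where
  "ext_log t = (if t > 0 then ereal (ln t) else -\<infinity>)"

definition log_lik ::
  "real ^ 'k::finite ^ 'p::finite \<Rightarrow> real ^ 'p \<Rightarrow> real ^ 'k \<Rightarrow> ereal" where
  "log_lik A X T = (\<Sum>a | X $ a > 0. ereal (X $ a) * ext_log ((A *v T) $ a))"

definition plug_in_estimate ::
  "real ^ 'k::finite ^ 'p::finite \<Rightarrow> real ^ 'p \<Rightarrow> real ^ 'k \<Rightarrow> bool" where
  "plug_in_estimate Ahat X That \<longleftrightarrow> is_arg_max (log_lik Ahat X) (\<lambda>T. T \<in> prob_simplex) That"

definition R_err ::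
  "real ^ 'k::finite ^ 'p::finite \<Rightarrow> real ^ 'k \<Rightarrow> real ^ 'k \<Rightarrow>
   real ^ 'k ^ 'p \<Rightarrow> real ^ 'k \<Rightarrow> real ^ 'k \<Rightarrow> real" where
  "R_err A Ti Tj Ahat That_i That_j =
     (MIN P\<in>perm_matrices.
        max_col_norm (Ahat - A ** P) +
        1 / 2 * (l1_norm (That_i - transpose P *v Ti) + l1_norm (That_j - transpose P *v Tj)))"

end

theory Submission
  imports Defs
begin

text \<open>
  All three bounds are instances of one stability property: for a cost \<open>0 \<le> D \<le> C\<close>, the distance
  \<open>W\<^sub>1(\<gamma>, \<eta>; D)\<close> is 1-Lipschitz in \<open>D\<close> for the maximum norm and \<open>C/2\<close>-Lipschitz in each marginal
  for the \<open>\<ell>\<^sub>1\<close>-norm (\<open>wasserstein1_stable\<close>). The dependence on \<open>D\<close> is clear, as a coupling has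
  total mass 1. For a marginal, a coupling of \<open>(\<gamma>, \<eta>)\<close> becomes one of \<open>(\<gamma>', \<eta>)\<close> after moving
  only the mass \<open>\<parallel>\<gamma>' - \<gamma>\<parallel>\<^sub>1 / 2\<close>, and moving a unit of mass raises the cost by at most \<open>C\<close>
  (\<open>coupling_perturb_marginal\<close>).

  Let \<open>P\<close> attain the minimum in the error \<open>R\<close>. Replacing \<open>A\<close> and \<open>T\<close> by \<open>B = A P\<close> and
  \<open>P\<^sup>T T\<close> relabels the topics: it leaves the mixtures \<open>A T\<close> and the distances between topic weights
  unchanged (\<open>mixture_permuted\<close>, \<open>wasserstein1_permute\<close>). After that, the three bounds read off
  as follows (\<open>wasserstein1_estimation_aligned\<close>). For mixtures the cost is fixed, and the marginals
  differ by at most \<open>\<parallel>A' - B\<parallel> + \<parallel>T' - P\<^sup>T T\<parallel>\<^sub>1\<close> for each document, where \<open>A'\<close> and \<open>T'\<close> are the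
  estimates and matrices carry the maximal column norm. For topic weights the marginals differ by
  \<open>\<parallel>T' - P\<^sup>T T\<parallel>\<^sub>1\<close>, and the topic distances differ by at most \<open>C \<parallel>A' - B\<parallel>\<close>: in the Wasserstein case by a second use of the stability property,
  with the columns as marginals, and in the total variation case, where \<open>C = 1\<close>, by the triangle
  inequality.
\<close>

section \<open>Couplings and their costs\<close>

lemma trace_dist_matrix:
  "trace (w ** dist_matrix D) = (\<Sum>a\<in>UNIV. \<Sum>b\<in>UNIV. w $ a $ b * D b a)"
  by (simp add: trace_def matrix_matrix_mult_def dist_matrix_def)

lemma couplings_nonempty:
  assumes "\<gamma> \<in> prob_simplex" "\<eta> \<in> prob_simplex"
  shows "couplings \<gamma> \<eta> \<noteq> {}"
proof -
  have "(\<chi> a b. \<gamma> $ a * \<eta> $ b) \<in> couplings \<gamma> \<eta>"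
    using assms
    by (auto simp: couplings_def prob_simplex_def simp flip: sum_distrib_left sum_distrib_right)
  then show ?thesis by blast
qed

lemma coupling_cost_nonneg:
  assumes "w \<in> couplings \<gamma> \<eta>" "\<And>a b. 0 \<le> D a b"
  shows "0 \<le> trace (w ** dist_matrix D)"
  using assms by (auto simp: trace_dist_matrix couplings_def intro!: sum_nonneg)

lemma coupling_cost_diff_le:
  assumes w: "w \<in> couplings \<gamma> \<eta>" and \<gamma>: "\<gamma> \<in> prob_simplex"
    and le: "\<And>a b. D' a b \<le> D a b + e"
  shows "trace (w ** dist_matrix D') \<le> trace (w ** dist_matrix D) + e"
proof -
  have "trace (w ** dist_matrix D') \<le> (\<Sum>a\<in>UNIV. \<Sum>b\<in>UNIV. w $ a $ b * (D b a + e))"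
    unfolding trace_dist_matrix using w le
    by (intro sum_mono mult_left_mono) (auto simp: couplings_def)
  also have "\<dots> = trace (w ** dist_matrix D) + (\<Sum>a\<in>UNIV. \<Sum>b\<in>UNIV. w $ a $ b) * e"
    by (simp add: trace_dist_matrix distrib_left sum.distrib sum_distrib_right)
  also have "(\<Sum>a\<in>UNIV. \<Sum>b\<in>UNIV. w $ a $ b) = 1"
    using w \<gamma> by (simp add: couplings_def prob_simplex_def)
  finally show ?thesis by simp
qed

lemma wasserstein1_le_coupling_cost:
  assumes "w \<in> couplings \<gamma> \<eta>" "\<And>a b. 0 \<le> D a b"
  shows "wasserstein1 \<gamma> \<eta> D \<le> trace (w ** dist_matrix D)"
  unfolding wasserstein1_def
  using assms coupling_cost_nonneg by (intro cINF_lower bdd_belowI2[where m = 0]) blast+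

text \<open>
  The distance is an infimum over couplings, so each comparison of two distances below reduces to
  transforming an arbitrary coupling for one into a coupling for the other.
\<close>

lemma wasserstein1_le_by_coupling_map:
  assumes "\<gamma> \<in> prob_simplex" "\<eta> \<in> prob_simplex" and "\<And>a b. 0 \<le> D' a b"
    and "\<And>w. w \<in> couplings \<gamma> \<eta> \<Longrightarrow>
      \<exists>w'\<in>couplings \<gamma>' \<eta>'. trace (w' ** dist_matrix D') \<le> trace (w ** dist_matrix D) + e"
  shows "wasserstein1 \<gamma>' \<eta>' D' \<le> wasserstein1 \<gamma> \<eta> D + e"
proof -
  have "wasserstein1 \<gamma>' \<eta>' D' - e \<le> wasserstein1 \<gamma> \<eta> D"
    unfolding wasserstein1_def[of \<gamma> \<eta>]
  proof (rule cINF_greatest[OF couplings_nonempty[OF assms(1,2)]])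
    fix w assume "w \<in> couplings \<gamma> \<eta>"
    from assms(4)[OF this] obtain w' where "w' \<in> couplings \<gamma>' \<eta>'"
      and "trace (w' ** dist_matrix D') \<le> trace (w ** dist_matrix D) + e" by blast
    with wasserstein1_le_coupling_cost[of w' \<gamma>' \<eta>' D'] assms(3)
    show "wasserstein1 \<gamma>' \<eta>' D' - e \<le> trace (w ** dist_matrix D)" by fastforce
  qed
  then show ?thesis by simp
qed

lemma wasserstein1_le_cost_perturbed:
  assumes "\<gamma> \<in> prob_simplex" "\<eta> \<in> prob_simplex"
    and "\<And>a b. 0 \<le> D' a b" "\<And>a b. D' a b \<le> D a b + e"
  shows "wasserstein1 \<gamma> \<eta> D' \<le> wasserstein1 \<gamma> \<eta> D + e"
  using assms coupling_cost_diff_le by (intro wasserstein1_le_by_coupling_map) blast+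

lemma wasserstein1_bounds:
  assumes "\<gamma> \<in> prob_simplex" "\<eta> \<in> prob_simplex"
    and "\<And>a b. 0 \<le> D a b" "\<And>a b. D a b \<le> C"
  shows "0 \<le> wasserstein1 \<gamma> \<eta> D" "wasserstein1 \<gamma> \<eta> D \<le> C"
proof -
  show "0 \<le> wasserstein1 \<gamma> \<eta> D"
    unfolding wasserstein1_def using assms coupling_cost_nonneg
    by (intro cINF_greatest couplings_nonempty) blast+
  obtain w where w: "w \<in> couplings \<gamma> \<eta>" using couplings_nonempty assms(1,2) by blast
  have "wasserstein1 \<gamma> \<eta> D \<le> trace (w ** dist_matrix D)"
    using w assms(3) by (rule wasserstein1_le_coupling_cost)
  also have "\<dots> \<le> trace (w ** dist_matrix (\<lambda>_ _. 0)) + C"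
    using w assms(1,4) by (intro coupling_cost_diff_le) auto
  finally show "wasserstein1 \<gamma> \<eta> D \<le> C" by (simp add: trace_dist_matrix)
qed

section \<open>Perturbation of the marginals\<close>

text \<open>
  From each row \<open>a\<close> keep only the proportion that fits under \<open>min (\<gamma> a) (\<gamma>' a)\<close>. The mass
  removed is half of the \<open>\<ell>\<^sub>1\<close>-distance of \<open>\<gamma>\<close> and \<open>\<gamma>'\<close>, and leaves deficits \<open>r\<close> in the columns;
  refill them from the rows in which \<open>\<gamma>'\<close> exceeds \<open>\<gamma>\<close>, as a product measure. Kept mass costs no
  more than before, and refilled mass at most \<open>C\<close> per unit.
\<close>

lemma coupling_perturb_marginal:
  assumes w: "w \<in> couplings \<gamma> \<eta>" and \<gamma>: "\<gamma> \<in> prob_simplex" and \<gamma>': "\<gamma>' \<in> prob_simplex"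
    and D0: "\<And>a b. 0 \<le> D a b" and DC: "\<And>a b. D a b \<le> C"
  shows "\<exists>w'\<in>couplings \<gamma>' \<eta>.
    trace (w' ** dist_matrix D) \<le> trace (w ** dist_matrix D) + C / 2 * l1_norm (\<gamma>' - \<gamma>)"
proof -
  have w0: "0 \<le> w $ a $ b" and row: "(\<Sum>b\<in>UNIV. w $ a $ b) = \<gamma> $ a"
    and col: "(\<Sum>a\<in>UNIV. w $ a $ b) = \<eta> $ b" for a b
    using w by (auto simp: couplings_def)
  have \<gamma>0: "0 \<le> \<gamma> $ a" and \<gamma>'0: "0 \<le> \<gamma>' $ a" for a
    using \<gamma> \<gamma>' by (auto simp: prob_simplex_def)
  define \<mu> where "\<mu> a = min (\<gamma> $ a) (\<gamma>' $ a)" for a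
  \<comment> \<open>An empty row has \<open>\<rho> a = 0\<close> by the convention on division by zero; the row of \<open>w\<close> is zero too.\<close>
  define \<rho> where "\<rho> a = \<mu> a / \<gamma> $ a" for a
  define r where "r b = (\<Sum>a\<in>UNIV. (1 - \<rho> a) * w $ a $ b)" for b
  define m where "m = (\<Sum>a\<in>UNIV. \<gamma> $ a - \<mu> a)"
  define w' where "w' = (\<chi> a b. \<rho> a * w $ a $ b + (\<gamma>' $ a - \<mu> a) * (r b / m))"
  have \<rho>\<gamma>: "\<rho> a * \<gamma> $ a = \<mu> a" for a
    using \<gamma>0[of a] \<gamma>'0[of a] by (auto simp: \<rho>_def \<mu>_def)
  have \<rho>0: "0 \<le> \<rho> a" and \<rho>1: "\<rho> a \<le> 1" for a
    using \<gamma>0[of a] \<gamma>'0[of a] by (auto simp: \<rho>_def \<mu>_def divide_le_eq_1)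
  have r0: "0 \<le> r b" for b
    unfolding r_def using w0 \<rho>1 by (intro sum_nonneg mult_nonneg_nonneg) auto
  have m0: "0 \<le> m" unfolding m_def \<mu>_def by (intro sum_nonneg) auto
  have sum_r: "(\<Sum>b\<in>UNIV. r b) = m"
  proof -
    have "(\<Sum>b\<in>UNIV. r b) = (\<Sum>a\<in>UNIV. \<Sum>b\<in>UNIV. (1 - \<rho> a) * w $ a $ b)"
      unfolding r_def by (rule sum.swap)
    also have "\<dots> = (\<Sum>a\<in>UNIV. (1 - \<rho> a) * \<gamma> $ a)"
      by (simp add: row flip: sum_distrib_left)
    finally show ?thesis by (simp add: m_def left_diff_distrib \<rho>\<gamma>)
  qed
  have sum_excess: "(\<Sum>a\<in>UNIV. \<gamma>' $ a - \<mu> a) = m"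
    using \<gamma> \<gamma>' by (simp add: m_def sum_subtractf prob_simplex_def)
  have m_half: "m = l1_norm (\<gamma>' - \<gamma>) / 2"
  proof -
    have "l1_norm (\<gamma>' - \<gamma>) = (\<Sum>a\<in>UNIV. (\<gamma>' $ a - \<mu> a) + (\<gamma> $ a - \<mu> a))"
      unfolding l1_norm_def \<mu>_def by (intro sum.cong) auto
    then show ?thesis using sum_excess by (simp only: sum.distrib flip: m_def) simp
  qed
  have row': "(\<Sum>b\<in>UNIV. w' $ a $ b) = \<gamma>' $ a" for a
  proof -
    have "(\<Sum>b\<in>UNIV. w' $ a $ b) = \<mu> a + (\<gamma>' $ a - \<mu> a) * (m / m)"
      by (simp add: w'_def sum.distrib row \<rho>\<gamma> sum_r
          flip: sum_distrib_left sum_divide_distrib times_divide_eq_right)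
    \<comment> \<open>If \<open>m = 0\<close>, then \<open>m / m = 0\<close>, but there is also nothing to refill.\<close>
    moreover have "\<gamma>' $ a = \<mu> a" if "m = 0"
    proof -
      have "\<forall>a\<in>UNIV. \<gamma>' $ a - \<mu> a = 0"
        using sum_excess that
        by (subst sum_nonneg_eq_0_iff[symmetric]) (auto simp: \<mu>_def)
      then show ?thesis by simp
    qed
    ultimately show ?thesis by (cases "m = 0") auto
  qed
  have col': "(\<Sum>a\<in>UNIV. w' $ a $ b) = \<eta> $ b" for b
  proof -
    have "(\<Sum>a\<in>UNIV. w' $ a $ b)
        = (\<Sum>a\<in>UNIV. \<rho> a * w $ a $ b) + (\<Sum>a\<in>UNIV. \<gamma>' $ a - \<mu> a) * (r b / m)"
      by (simp add: w'_def sum.distrib sum_distrib_right sum_divide_distrib)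
    then have "(\<Sum>a\<in>UNIV. w' $ a $ b) = (\<Sum>a\<in>UNIV. \<rho> a * w $ a $ b) + m * (r b / m)"
      by (simp only: sum_excess)
    moreover have "r b = 0" if "m = 0"
      using sum_r r0 that by (simp add: sum_nonneg_eq_0_iff)
    moreover have "r b = \<eta> $ b - (\<Sum>a\<in>UNIV. \<rho> a * w $ a $ b)"
      by (simp add: r_def left_diff_distrib sum_subtractf col)
    ultimately show ?thesis by (cases "m = 0") auto
  qed
  have "w' \<in> couplings \<gamma>' \<eta>"
    unfolding couplings_def using row' col' w0 \<rho>0 r0 m0
    by (auto simp: w'_def \<mu>_def intro!: add_nonneg_nonneg mult_nonneg_nonneg divide_nonneg_nonneg)
  moreover have "trace (w' ** dist_matrix D) \<le> trace (w ** dist_matrix D) + C * m"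
  proof -
    have "w' $ a $ b * D b a \<le> w $ a $ b * D b a + C * ((\<gamma>' $ a - \<mu> a) * (r b / m))" for a b
    proof -
      have "\<rho> a * w $ a $ b * D b a \<le> w $ a $ b * D b a"
        using mult_right_mono[OF mult_right_mono[OF \<rho>1[of a] w0[of a b]] D0[of b a]] by simp
      moreover have "0 \<le> (\<gamma>' $ a - \<mu> a) * (r b / m)"
        using r0 m0 by (auto simp: \<mu>_def intro!: mult_nonneg_nonneg divide_nonneg_nonneg)
      then have "(\<gamma>' $ a - \<mu> a) * (r b / m) * D b a \<le> (\<gamma>' $ a - \<mu> a) * (r b / m) * C"
        using DC by (rule mult_left_mono[rotated])
      ultimately show ?thesis by (simp add: w'_def distrib_left mult.commute)
    qed
    then have "trace (w' ** dist_matrix D)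
        \<le> (\<Sum>a\<in>UNIV. \<Sum>b\<in>UNIV. w $ a $ b * D b a + C * ((\<gamma>' $ a - \<mu> a) * (r b / m)))"
      unfolding trace_dist_matrix by (intro sum_mono)
    also have "\<dots> = trace (w ** dist_matrix D)
        + C * ((\<Sum>a\<in>UNIV. \<gamma>' $ a - \<mu> a) * (\<Sum>b\<in>UNIV. r b / m))"
      unfolding sum_product unfolding sum_distrib_left
      by (simp add: trace_dist_matrix sum.distrib)
    also have "\<dots> = trace (w ** dist_matrix D) + C * (m * (m / m))"
      by (simp only: sum_excess sum_r flip: sum_divide_distrib)
    finally show ?thesis by (cases "m = 0") simp_all
  qed
  ultimately show ?thesis unfolding m_half by (intro bexI[of _ w']) auto
qed

lemma wasserstein1_le_first_marginal:
  assumes "\<gamma> \<in> prob_simplex" "\<gamma>' \<in> prob_simplex" "\<eta> \<in> prob_simplex"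
    and "\<And>a b. 0 \<le> D a b" "\<And>a b. D a b \<le> C"
  shows "wasserstein1 \<gamma>' \<eta> D \<le> wasserstein1 \<gamma> \<eta> D + C / 2 * l1_norm (\<gamma>' - \<gamma>)"
  using assms by (intro wasserstein1_le_by_coupling_map coupling_perturb_marginal) auto

lemma wasserstein1_swap:
  "wasserstein1 \<gamma> \<eta> D = wasserstein1 \<eta> \<gamma> (\<lambda>a b. D b a)"
proof -
  have "couplings \<gamma> \<eta> = transpose ` couplings \<eta> \<gamma>"
  proof (intro equalityI subsetI)
    fix w assume "w \<in> couplings \<gamma> \<eta>"
    then have "transpose w \<in> couplings \<eta> \<gamma>" by (auto simp: couplings_def transpose_def)
    then show "w \<in> transpose ` couplings \<eta> \<gamma>" by (metis imageI transpose_transpose)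
  qed (auto simp: couplings_def transpose_def)
  moreover have "trace (transpose w ** dist_matrix D) = trace (w ** dist_matrix (\<lambda>a b. D b a))" for w
    unfolding trace_dist_matrix transpose_def by (subst sum.swap) simp
  ultimately show ?thesis by (simp add: wasserstein1_def image_image)
qed

text \<open>
  Perturb one marginal at a time. Exchanging the marginals transposes \<open>D\<close>, which keeps the bounds
  \<open>0\<close> and \<open>C\<close>, so the result for the first marginal also gives that for the second.
\<close>

lemma wasserstein1_le_marginals:
  assumes "\<gamma> \<in> prob_simplex" "\<gamma>' \<in> prob_simplex" "\<eta> \<in> prob_simplex" "\<eta>' \<in> prob_simplex"
    and "\<And>a b. 0 \<le> D a b" "\<And>a b. D a b \<le> C"
  shows "wasserstein1 \<gamma>' \<eta>' D
    \<le> wasserstein1 \<gamma> \<eta> D + C / 2 * (l1_norm (\<gamma>' - \<gamma>) + l1_norm (\<eta>' - \<eta>))"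
proof -
  have "wasserstein1 \<gamma>' \<eta>' D \<le> wasserstein1 \<gamma> \<eta>' D + C / 2 * l1_norm (\<gamma>' - \<gamma>)"
    using assms by (intro wasserstein1_le_first_marginal) auto
  moreover have "wasserstein1 \<gamma> \<eta>' D \<le> wasserstein1 \<gamma> \<eta> D + C / 2 * l1_norm (\<eta>' - \<eta>)"
    unfolding wasserstein1_swap[of \<gamma>] using assms
    by (intro wasserstein1_le_first_marginal) auto
  ultimately show ?thesis by (simp add: distrib_left)
qed

lemma l1_norm_minus_commute: "l1_norm (u - v) = l1_norm (v - u)"
  by (simp add: l1_norm_def abs_minus_commute)

text \<open>
  Change the cost first, at the marginals \<open>(\<gamma>', \<eta>')\<close>, and then the marginals, at the cost \<open>D\<close>.
\<close>

lemma wasserstein1_stable: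
  assumes simplex: "\<gamma> \<in> prob_simplex" "\<gamma>' \<in> prob_simplex" "\<eta> \<in> prob_simplex" "\<eta>' \<in> prob_simplex"
    and D: "\<And>a b. 0 \<le> D a b" "\<And>a b. D a b \<le> C" and D': "\<And>a b. 0 \<le> D' a b"
    and diff: "\<And>a b. \<bar>D' a b - D a b\<bar> \<le> e"
  shows "\<bar>wasserstein1 \<gamma>' \<eta>' D' - wasserstein1 \<gamma> \<eta> D\<bar>
    \<le> e + C / 2 * (l1_norm (\<gamma>' - \<gamma>) + l1_norm (\<eta>' - \<eta>))"
proof -
  have "D' a b \<le> D a b + e" "D a b \<le> D' a b + e" for a b using diff[of a b] by auto
  then have "wasserstein1 \<gamma>' \<eta>' D' \<le> wasserstein1 \<gamma>' \<eta>' D + e"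
    and "wasserstein1 \<gamma>' \<eta>' D \<le> wasserstein1 \<gamma>' \<eta>' D' + e"
    using simplex D D' by (auto intro!: wasserstein1_le_cost_perturbed)
  moreover have "wasserstein1 \<gamma>' \<eta>' D
      \<le> wasserstein1 \<gamma> \<eta> D + C / 2 * (l1_norm (\<gamma>' - \<gamma>) + l1_norm (\<eta>' - \<eta>))"
    and "wasserstein1 \<gamma> \<eta> D
      \<le> wasserstein1 \<gamma>' \<eta>' D + C / 2 * (l1_norm (\<gamma> - \<gamma>') + l1_norm (\<eta> - \<eta>'))"
    using simplex D by (intro wasserstein1_le_marginals; blast)+
  ultimately show ?thesis
    unfolding l1_norm_minus_commute[of \<gamma>] l1_norm_minus_commute[of \<eta>] by linarith
qed

section \<open>Mixtures and column norms\<close>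

lemma l1_norm_triangle: "l1_norm (u + v) \<le> l1_norm u + l1_norm v"
  unfolding l1_norm_def sum.distrib[symmetric] by (intro sum_mono) (simp add: abs_triangle_ineq)

lemma l1_norm_prob_simplex: "v \<in> prob_simplex \<Longrightarrow> l1_norm v = 1"
  by (simp add: l1_norm_def prob_simplex_def)

lemma l1_norm_column_le: "l1_norm (column k B) \<le> max_col_norm B"
  unfolding max_col_norm_def by (intro Max_ge) auto

lemma l1_norm_matrix_vector_le: "l1_norm (B *v v) \<le> max_col_norm B * l1_norm v"
proof -
  have "l1_norm (B *v v) \<le> (\<Sum>a\<in>UNIV. \<Sum>k\<in>UNIV. \<bar>B $ a $ k\<bar> * \<bar>v $ k\<bar>)"
    unfolding l1_norm_def matrix_vector_mult_def
    by (auto intro!: sum_mono order.trans[OF sum_abs] simp: abs_mult)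
  also have "\<dots> = (\<Sum>k\<in>UNIV. l1_norm (column k B) * \<bar>v $ k\<bar>)"
    by (subst sum.swap) (simp add: l1_norm_def column_def sum_distrib_right)
  also have "\<dots> \<le> (\<Sum>k\<in>UNIV. max_col_norm B * \<bar>v $ k\<bar>)"
    by (intro sum_mono mult_right_mono l1_norm_column_le) auto
  finally show ?thesis by (simp add: l1_norm_def sum_distrib_left)
qed

lemma column_diff: "column k (A - B) = column k A - column k B"
  by (simp add: column_def vec_eq_iff)

lemma max_col_norm_stochastic:
  assumes "\<And>k. column k B \<in> prob_simplex"
  shows "max_col_norm B = 1"
  using assms by (simp add: max_col_norm_def l1_norm_prob_simplex)

lemma mixture_in_prob_simplex:
  assumes B: "\<And>k. column k B \<in> prob_simplex" and v: "v \<in> prob_simplex"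
  shows "B *v v \<in> prob_simplex"
proof -
  have "0 \<le> B $ a $ k" and sum: "(\<Sum>a\<in>UNIV. B $ a $ k) = 1" for a k
    using B[of k] by (auto simp: prob_simplex_def column_def)
  moreover have "(\<Sum>a\<in>UNIV. \<Sum>k\<in>UNIV. B $ a $ k * v $ k) = (\<Sum>k\<in>UNIV. v $ k)"
    by (subst sum.swap) (simp add: sum flip: sum_distrib_right)
  ultimately show ?thesis
    using v by (auto simp: prob_simplex_def matrix_vector_mult_def intro!: sum_nonneg)
qed

text \<open>
  Split \<open>B' v' - B v\<close> as \<open>(B' - B) v' + B (v' - v)\<close>; both \<open>v'\<close> and the columns of \<open>B\<close> have norm 1.
\<close>

lemma l1_norm_mixture_diff_le:
  assumes "\<And>k. column k B \<in> prob_simplex" and "v' \<in> prob_simplex"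
  shows "l1_norm (B' *v v' - B *v v) \<le> max_col_norm (B' - B) + l1_norm (v' - v)"
proof -
  have "B' *v v' - B *v v = (B' - B) *v v' + B *v (v' - v)"
    by (simp add: matrix_vector_mult_diff_rdistrib matrix_vector_mult_diff_distrib)
  then have "l1_norm (B' *v v' - B *v v) \<le> l1_norm ((B' - B) *v v') + l1_norm (B *v (v' - v))"
    by (simp add: l1_norm_triangle)
  also have "\<dots> \<le> max_col_norm (B' - B) * l1_norm v' + max_col_norm B * l1_norm (v' - v)"
    by (intro add_mono l1_norm_matrix_vector_le)
  finally show ?thesis using assms by (simp add: max_col_norm_stochastic l1_norm_prob_simplex)
qed

section \<open>Ground distances\<close>

lemma D_word_nonneg: "0 \<le> D_word x a b"
  by (simp add: D_word_def)

lemma D_word_le_max_entry_norm: "D_word x a b \<le> max_entry_norm (dist_matrix (D_word x))"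
proof -
  have "\<bar>D_word x a b\<bar> \<le> max_entry_norm (dist_matrix (D_word x))"
    unfolding max_entry_norm_def by (intro Max_ge)
      (auto simp: dist_matrix_def intro: image_eqI[of _ _ "(a, b)"])
  then show ?thesis by simp
qed

lemma D_topic_W_bounds:
  assumes "\<And>k. column k A \<in> prob_simplex"
  shows "0 \<le> D_topic_W x A k l" "D_topic_W x A k l \<le> max_entry_norm (dist_matrix (D_word x))"
  unfolding D_topic_W_def
  by (rule wasserstein1_bounds[OF assms assms D_word_nonneg D_word_le_max_entry_norm])+

lemma D_topic_TV_bounds:
  assumes "\<And>k. column k A \<in> prob_simplex"
  shows "0 \<le> D_topic_TV A k l" "D_topic_TV A k l \<le> 1"
proof -
  have "l1_norm (column k A + - column l A) \<le> l1_norm (column k A) + l1_norm (- column l A)"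
    by (rule l1_norm_triangle)
  moreover have "l1_norm (- column l A) = l1_norm (column l A)" by (simp add: l1_norm_def)
  ultimately show "D_topic_TV A k l \<le> 1"
    using assms by (simp add: D_topic_TV_def l1_norm_prob_simplex)
  show "0 \<le> D_topic_TV A k l" by (simp add: D_topic_TV_def l1_norm_def sum_nonneg)
qed

text \<open>
  A distance between topics is a Wasserstein distance between columns, so the stability property
  applies, with the cost fixed. Each of the two columns changes by at most the maximal column norm
  of the difference, and the two contributions cancel the factor \<open>1/2\<close>.
\<close>

lemma D_topic_W_diff_le:
  assumes "\<And>k. column k A \<in> prob_simplex" "\<And>k. column k B \<in> prob_simplex"
  shows "\<bar>D_topic_W x B k l - D_topic_W x A k l\<bar>
    \<le> max_entry_norm (dist_matrix (D_word x)) * max_col_norm (B - A)"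
    (is "_ \<le> ?C * _")
proof -
  have "\<bar>D_topic_W x B k l - D_topic_W x A k l\<bar>
      \<le> 0 + ?C / 2 * (l1_norm (column k B - column k A) + l1_norm (column l B - column l A))"
    unfolding D_topic_W_def
    by (intro wasserstein1_stable assms D_word_nonneg D_word_le_max_entry_norm) auto
  also have "\<dots> \<le> ?C / 2 * (max_col_norm (B - A) + max_col_norm (B - A))"
    unfolding column_diff[symmetric] add_0
    using order.trans[OF D_word_nonneg D_word_le_max_entry_norm[of x]]
    by (intro mult_left_mono add_mono l1_norm_column_le) simp
  finally show ?thesis by simp
qed

lemma D_topic_TV_diff_le:
  "\<bar>D_topic_TV B k l - D_topic_TV A k l\<bar> \<le> max_col_norm (B - A)"
proof -
  let ?u = "column k B - column l B" and ?v = "column k A - column l A"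
  let ?e = "\<lambda>k. column k (B - A)"
  have "l1_norm ?u \<le> l1_norm ?v + l1_norm (?u - ?v)" "l1_norm ?v \<le> l1_norm ?u + l1_norm (?v - ?u)"
    using l1_norm_triangle[of ?v "?u - ?v"] l1_norm_triangle[of ?u "?v - ?u"] by simp_all
  moreover have "l1_norm (?u - ?v) \<le> 2 * max_col_norm (B - A)"
  proof -
    have "?u - ?v = ?e k + - ?e l" by (simp add: column_diff)
    then have "l1_norm (?u - ?v) \<le> l1_norm (?e k) + l1_norm (- ?e l)"
      by (simp only: l1_norm_triangle)
    also have "l1_norm (- ?e l) = l1_norm (?e l)" by (simp add: l1_norm_def)
    finally show ?thesis using l1_norm_column_le[of k "B - A"] l1_norm_column_le[of l "B - A"] by simp
  qed
  ultimately show ?thesis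
    unfolding D_topic_TV_def using l1_norm_minus_commute[of ?u ?v] by (simp add: abs_le_iff field_simps)
qed

section \<open>Relabelling of topics\<close>

text \<open>
  One inequality suffices for the equality below, by applying it to the inverse permutation.
\<close>

lemma wasserstein1_permute_le:
  fixes s :: "'k::finite \<Rightarrow> 'k"
  assumes s: "s permutes UNIV" and "\<gamma> \<in> prob_simplex" "\<eta> \<in> prob_simplex" "\<And>a b. 0 \<le> D a b"
  shows "wasserstein1 (\<chi> a. \<gamma> $ s a) (\<chi> a. \<eta> $ s a) (\<lambda>a b. D (s a) (s b)) \<le> wasserstein1 \<gamma> \<eta> D"
proof -
  have sum: "(\<Sum>a\<in>UNIV. f (s a)) = sum f UNIV" for f :: "'k \<Rightarrow> real"
    using sum.permute[OF s, of f] by (simp add: o_def)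
  have "\<exists>w'\<in>couplings (\<chi> a. \<gamma> $ s a) (\<chi> a. \<eta> $ s a).
      trace (w' ** dist_matrix (\<lambda>a b. D (s a) (s b))) \<le> trace (w ** dist_matrix D) + 0"
    if w: "w \<in> couplings \<gamma> \<eta>" for w
  proof (rule bexI[where x = "\<chi> a b. w $ s a $ s b"])
    show "(\<chi> a b. w $ s a $ s b) \<in> couplings (\<chi> a. \<gamma> $ s a) (\<chi> a. \<eta> $ s a)"
      using w sum[of "\<lambda>b. w $ _ $ b"] sum[of "\<lambda>a. w $ a $ _"] by (simp add: couplings_def)
    show "trace ((\<chi> a b. w $ s a $ s b) ** dist_matrix (\<lambda>a b. D (s a) (s b)))
        \<le> trace (w ** dist_matrix D) + 0"
      using sum[of "\<lambda>b. w $ _ $ b * D b _"] sum[of "\<lambda>a. \<Sum>b\<in>UNIV. w $ a $ b * D b a"]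
      by (simp add: trace_dist_matrix)
  qed
  then have "wasserstein1 (\<chi> a. \<gamma> $ s a) (\<chi> a. \<eta> $ s a) (\<lambda>a b. D (s a) (s b)) \<le> wasserstein1 \<gamma> \<eta> D + 0"
    using assms by (intro wasserstein1_le_by_coupling_map) auto
  then show ?thesis by simp
qed

lemma permuted_in_prob_simplex:
  fixes s :: "'k::finite \<Rightarrow> 'k"
  assumes "s permutes UNIV" "\<gamma> \<in> prob_simplex"
  shows "(\<chi> a. \<gamma> $ s a) \<in> prob_simplex"
  using assms(2) sum.permute[OF assms(1), of "($) \<gamma>"] by (simp add: prob_simplex_def o_def)

lemma wasserstein1_permute:
  fixes s :: "'k::finite \<Rightarrow> 'k"
  assumes s: "s permutes UNIV" and "\<gamma> \<in> prob_simplex" "\<eta> \<in> prob_simplex" "\<And>a b. 0 \<le> D a b"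
  shows "wasserstein1 (\<chi> a. \<gamma> $ s a) (\<chi> a. \<eta> $ s a) (\<lambda>a b. D (s a) (s b)) = wasserstein1 \<gamma> \<eta> D"
proof (rule antisym)
  show "wasserstein1 \<gamma> \<eta> D \<le> wasserstein1 (\<chi> a. \<gamma> $ s a) (\<chi> a. \<eta> $ s a) (\<lambda>a b. D (s a) (s b))"
    using wasserstein1_permute_le[OF permutes_inv[OF s] permuted_in_prob_simplex[OF s assms(2)]
        permuted_in_prob_simplex[OF s assms(3)], of "\<lambda>a b. D (s a) (s b)"] assms(4)
    by (simp add: permutes_inverses[OF s])
qed (intro wasserstein1_permute_le assms)

lemma column_mult_permutation:
  fixes A :: "real ^ 'k::finite ^ 'p::finite" and s :: "'k \<Rightarrow> 'k"
  shows "column b (A ** (\<chi> a b. if a = s b then 1 else 0)) = column (s b) A"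
  by (simp add: column_def matrix_matrix_mult_def vec_eq_iff if_distrib cong: if_cong)

lemma transpose_permutation_mult:
  fixes v :: "real ^ 'k::finite" and s :: "'k \<Rightarrow> 'k"
  shows "transpose (\<chi> a b. if a = s b then 1 else 0) *v v = (\<chi> b. v $ s b)"
  by (simp add: transpose_def matrix_vector_mult_def vec_eq_iff if_distrib
      [of "\<lambda>t. t * _"] cong: if_cong)

lemma mixture_permuted:
  fixes A :: "real ^ 'k::finite ^ 'p::finite" and s :: "'k \<Rightarrow> 'k"
  assumes "s permutes UNIV"
  shows "(A ** (\<chi> a b. if a = s b then 1 else 0)) *v (\<chi> b. v $ s b) = A *v v"
proof -
  have "(A ** (\<chi> a b. if a = s b then 1 else 0)) $ c $ b = A $ c $ s b" for c b
    using column_mult_permutation[of b A s] by (simp add: column_def vec_eq_iff)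
  then show ?thesis
    using sum.permute[OF assms, of "\<lambda>k. A $ _ $ k * v $ k"]
    by (simp add: matrix_vector_mult_def vec_eq_iff o_def)
qed

lemma finite_perm_matrices: "finite (perm_matrices :: (real ^ 'k::finite ^ 'k) set)"
proof -
  have "perm_matrices = (\<lambda>s. (\<chi> a b. if a = s b then 1 else 0) :: real ^ 'k ^ 'k) ` {s. s permutes UNIV}"
    by (auto simp: perm_matrices_def)
  moreover have "finite {s :: 'k \<Rightarrow> 'k. s permutes UNIV}" by (rule finite)
  ultimately show ?thesis by (metis finite_imageI)
qed

lemma perm_matrices_nonempty: "perm_matrices \<noteq> {}"
  unfolding perm_matrices_def using permutes_id by blast

lemma R_err_attained:
  obtains s where "s permutes UNIV"
    and "R_err A Ti Tj Ahat That_i That_j =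
      max_col_norm (Ahat - A ** (\<chi> a b. if a = s b then 1 else 0)) +
      1 / 2 * (l1_norm (That_i - (\<chi> b. Ti $ s b)) + l1_norm (That_j - (\<chi> b. Tj $ s b)))"
proof -
  have "R_err A Ti Tj Ahat That_i That_j \<in> (\<lambda>P. max_col_norm (Ahat - A ** P) + 
      1 / 2 * (l1_norm (That_i - transpose P *v Ti) + l1_norm (That_j - transpose P *v Tj))) ` perm_matrices"
    unfolding R_err_def using finite_perm_matrices perm_matrices_nonempty by (intro Min_in) auto
  then show thesis
    using that
    by (auto simp: perm_matrices_def transpose_permutation_mult simp del: transpose_matrix_vector)
qed

section \<open>Error bounds\<close>

text \<open>
  Here the topics are already aligned, so that \<open>r\<close> stands for the value of the minimised expression
  at one permutation.
\<close>

lemma wasserstein1_estimation_aligned: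
  fixes x :: "'p::finite \<Rightarrow> real ^ 'd::finite" and B B' :: "real ^ 'k::finite ^ 'p"
  assumes B: "\<And>k. column k B \<in> prob_simplex" and B': "\<And>k. column k B' \<in> prob_simplex"
    and simplex: "u \<in> prob_simplex" "v \<in> prob_simplex" "u' \<in> prob_simplex" "v' \<in> prob_simplex"
  defines "C \<equiv> max_entry_norm (dist_matrix (D_word x))"
    and "r \<equiv> max_col_norm (B' - B) + 1 / 2 * (l1_norm (u' - u) + l1_norm (v' - v))"
  shows "\<bar>wasserstein1 (B' *v u') (B' *v v') (D_word x)
      - wasserstein1 (B *v u) (B *v v) (D_word x)\<bar> \<le> C * r" (is ?mixture)
    and "\<bar>wasserstein1 u' v' (D_topic_W x B') - wasserstein1 u v (D_topic_W x B)\<bar> \<le> C * r"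
      (is ?topic_W)
    and "\<bar>wasserstein1 u' v' (D_topic_TV B') - wasserstein1 u v (D_topic_TV B)\<bar> \<le> r" (is ?topic_TV)
proof -
  have C0: "0 \<le> C"
    unfolding C_def by (rule order.trans[OF D_word_nonneg D_word_le_max_entry_norm])
  show ?mixture
  proof -
    have "\<bar>wasserstein1 (B' *v u') (B' *v v') (D_word x) - wasserstein1 (B *v u) (B *v v) (D_word x)\<bar>
        \<le> 0 + C / 2 * (l1_norm (B' *v u' - B *v u) + l1_norm (B' *v v' - B *v v))"
      unfolding C_def using B B' simplex
      by (intro wasserstein1_stable mixture_in_prob_simplex D_word_nonneg D_word_le_max_entry_norm) auto
    also have "\<dots> \<le> 0 + C / 2 * ((max_col_norm (B' - B) + l1_norm (u' - u))
        + (max_col_norm (B' - B) + l1_norm (v' - v)))"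
      using C0 B simplex by (intro add_mono mult_left_mono l1_norm_mixture_diff_le) auto
    finally show ?thesis by (simp add: r_def field_simps)
  qed
  show ?topic_W
    using wasserstein1_stable[OF simplex(1,3,2,4) D_topic_W_bounds[OF B] D_topic_W_bounds(1)[OF B']
        D_topic_W_diff_le[OF B B']]
    unfolding C_def r_def by (simp add: field_simps)
  show ?topic_TV
    using wasserstein1_stable[OF simplex(1,3,2,4) D_topic_TV_bounds[OF B] D_topic_TV_bounds(1)[OF B']
        D_topic_TV_diff_le]
    unfolding r_def by simp
qed

theorem proposition12:
  fixes M :: "'w measure"
    and A :: "real ^ 'k::finite ^ 'p::finite"
    and T :: "'n::finite \<Rightarrow> real ^ 'k"
    and N :: "'n \<Rightarrow> nat"
    and X :: "'n \<Rightarrow> 'w \<Rightarrow> real ^ 'p"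
    and x :: "'p \<Rightarrow> real ^ 'd::finite"
    and Ahat :: "'w \<Rightarrow> real ^ 'k ^ 'p"
    and That :: "'n \<Rightarrow> 'w \<Rightarrow> real ^ 'k"
    and i j :: 'n
  assumes "prob_space M"
    and "\<And>k. column k A \<in> prob_simplex"
    and "\<And>l. l \<in> {i, j} \<Longrightarrow> T l \<in> prob_simplex"
    and "\<And>l. l \<in> {i, j} \<Longrightarrow> N l > 0"
    and "\<And>l. l \<in> {i, j} \<Longrightarrow> X l \<in> borel_measurable M"
    and "\<And>l. l \<in> {i, j} \<Longrightarrow>
           distr M borel (\<lambda>\<omega>. real (N l) *\<^sub>R X l \<omega>) = multinomial (N l) (A *v T l)"
    and "\<And>\<omega> k. \<omega> \<in> space M \<Longrightarrow> column k (Ahat \<omega>) \<in> prob_simplex"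
    and "\<And>\<omega> l. \<omega> \<in> space M \<Longrightarrow> l \<in> {i, j} \<Longrightarrow> plug_in_estimate (Ahat \<omega>) (X l \<omega>) (That l \<omega>)"
  shows "\<forall>\<omega>\<in>space M.
     \<bar>wasserstein1 (Ahat \<omega> *v That i \<omega>) (Ahat \<omega> *v That j \<omega>) (D_word x)
        - wasserstein1 (A *v T i) (A *v T j) (D_word x)\<bar>
       \<le> max_entry_norm (dist_matrix (D_word x)) * R_err A (T i) (T j) (Ahat \<omega>) (That i \<omega>) (That j \<omega>)
   \<and> \<bar>wasserstein1 (That i \<omega>) (That j \<omega>) (D_topic_W x (Ahat \<omega>))
        - wasserstein1 (T i) (T j) (D_topic_W x A)\<bar>
       \<le> max_entry_norm (dist_matrix (D_word x)) * R_err A (T i) (T j) (Ahat \<omega>) (That i \<omega>) (That j \<omega>)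
   \<and> \<bar>wasserstein1 (That i \<omega>) (That j \<omega>) (D_topic_TV (Ahat \<omega>))
        - wasserstein1 (T i) (T j) (D_topic_TV A)\<bar>
       \<le> R_err A (T i) (T j) (Ahat \<omega>) (That i \<omega>) (That j \<omega>)"
proof
  fix \<omega> assume \<omega>: "\<omega> \<in> space M"
  let ?C = "max_entry_norm (dist_matrix (D_word x))"
    and ?R = "R_err A (T i) (T j) (Ahat \<omega>) (That i \<omega>) (That j \<omega>)"
  have That: "That i \<omega> \<in> prob_simplex" "That j \<omega> \<in> prob_simplex"
    using assms(8)[OF \<omega>] by (auto simp: plug_in_estimate_def is_arg_max_def)
  have T: "T i \<in> prob_simplex" "T j \<in> prob_simplex" using assms(3) by auto
  obtain s where s: "s permutes (UNIV :: 'k set)"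
    and R: "?R = max_col_norm (Ahat \<omega> - A ** (\<chi> a b. if a = s b then 1 else 0)) +
      1 / 2 * (l1_norm (That i \<omega> - (\<chi> b. T i $ s b)) + l1_norm (That j \<omega> - (\<chi> b. T j $ s b)))"
    by (rule R_err_attained)
  define B where "B = A ** (\<chi> a b. if a = s b then 1 else 0)"
  have column_B: "column b B = column (s b) A" for b
    unfolding B_def by (rule column_mult_permutation)
  then have B: "column b B \<in> prob_simplex" for b using assms(2) by simp
  have mixture: "B *v (\<chi> b. T l $ s b) = A *v T l" for l
    unfolding B_def using s by (rule mixture_permuted)
  have "wasserstein1 (\<chi> b. T i $ s b) (\<chi> b. T j $ s b) (D_topic_W x B)
      = wasserstein1 (T i) (T j) (D_topic_W x A)"
    using wasserstein1_permute[OF s T D_topic_W_bounds(1)[OF assms(2), of x]]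
    by (simp add: D_topic_W_def[abs_def] column_B)
  moreover have "wasserstein1 (\<chi> b. T i $ s b) (\<chi> b. T j $ s b) (D_topic_TV B)
      = wasserstein1 (T i) (T j) (D_topic_TV A)"
    using wasserstein1_permute[OF s T D_topic_TV_bounds(1)[OF assms(2)]]
    by (simp add: D_topic_TV_def[abs_def] column_B)
  moreover note aligned = B assms(7)[OF \<omega>] permuted_in_prob_simplex[OF s T(1)]
    permuted_in_prob_simplex[OF s T(2)] That
  ultimately show "\<bar>wasserstein1 (Ahat \<omega> *v That i \<omega>) (Ahat \<omega> *v That j \<omega>) (D_word x)
        - wasserstein1 (A *v T i) (A *v T j) (D_word x)\<bar> \<le> ?C * ?R
   \<and> \<bar>wasserstein1 (That i \<omega>) (That j \<omega>) (D_topic_W x (Ahat \<omega>))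
        - wasserstein1 (T i) (T j) (D_topic_W x A)\<bar> \<le> ?C * ?R
   \<and> \<bar>wasserstein1 (That i \<omega>) (That j \<omega>) (D_topic_TV (Ahat \<omega>))
        - wasserstein1 (T i) (T j) (D_topic_TV A)\<bar> \<le> ?R"
    using wasserstein1_estimation_aligned(1,2)[OF aligned, of x]
      wasserstein1_estimation_aligned(3)[OF aligned]
    by (simp add: R mixture flip: B_def)
qed

end
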